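(* Let $\Omega\subseteq\mathbb{C}$ be open and let $F$ be analytic on $\Omega$. Let $\{b_i\}_{i\ge0},\{x_i\}_{i\ge0}\subseteq\Omega$ be such that the $b_i$ are pairwise distinct, $\{x_i\}$ is bounded, $\lim_{i\to\infty}b_i=b\in\Omega$ with $b\ne b_0$, and $\inf\{|1/x_i-b|: i\ge 0\}>0$. Suppose further that $\limsup_{k\to\infty}|\lambda_k|<\infty$, where $$\lambda_k=\mathbb{D}^{(k)}_{(1-xy,x-y)}\left[\begin{matrix}b_1,b_2,\dots,b_{k+1}\\ x_1,\dots,x_{k-1}\end{matrix}\right]\{F(x)\}\Big/\mathbb{D}^{(k)}_{(1-xy,x-y)}\left[\begin{matrix}b_0,b_1,\dots,b_k\\ x_1,\dots,x_{k-1}\end{matrix}\right]\{F(x)\}$$ (all denominators occurring being nonzero). Then there exists an open set $\Omega_1\subseteq\Omega$ containing $b$ such that for all $x\in\Omega_1$, $$F(x)=\sum_{k=0}^{\infty}(1-x_kb_k)\left\{\mathbb{D}^{(k)}_{(1-xy,x-y)}\left[\begin{matrix}b_0,b_1,\dots,b_k\\ x_1,\dots,x_{k-1}\end{matrix}\right]\{F(x)\}\right\}\frac{\prod_{i=0}^{k-1}(b_i-x)}{\prod_{i=1}^{k}(1-x\,x_i)}.$$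
   Context: For pairwise distinct nodes $c_0,\dots,c_k$ the operator is $$\mathbb{D}^{(k)}_{(1-xy,x-y)}\left[\begin{matrix}c_0,c_1,\dots,c_k\\ x_1,\dots,x_{k-1}\end{matrix}\right]\{F(x)\}=\sum_{j=0}^{k}F(c_j)\frac{\prod_{i=1}^{k-1}(1-x_ic_j)}{\prod_{i=0,\,i\ne j}^{k}(c_i-c_j)},$$ where the numerator product is empty ($=1$) for $k=1$, and for $k=0$ the value is $F(c_0)/(1-x_0c_0)$. If $x_i=0$, $|1/x_i-b|$ is read as $+\infty$. *)

theory Defs
  imports "HOL-Complex_Analysis.Complex_Analysis"
begin

text \<open>
  The divided difference operator for the pair \<open>(1 - xy, x - y)\<close>, with nodes \<open>c\<^sub>0, \<dots>, c\<^sub>k\<close> and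
  parameters \<open>x\<^sub>1, \<dots>, x\<^bsub>k-1\<^esub>\<close>, applied to \<open>F\<close>. The nodes and parameters are passed as whole sequences.
  The value at \<open>k = 0\<close> follows a separate convention, and it is the only one that uses \<open>x\<^sub>0\<close>.
\<close>

definition DD :: "nat \<Rightarrow> (nat \<Rightarrow> complex) \<Rightarrow> (nat \<Rightarrow> complex) \<Rightarrow> (complex \<Rightarrow> complex) \<Rightarrow> complex" where
  "DD k c x F =
    (if k = 0 then F (c 0) / (1 - x 0 * c 0)
     else \<Sum>j=0..k. F (c j) * ((\<Prod>i=1..<k. 1 - x i * c j) / (\<Prod>i\<in>{0..k} - {j}. c i - c j)))"

definition DD_ratio :: "(nat \<Rightarrow> complex) \<Rightarrow> (nat \<Rightarrow> complex) \<Rightarrow> (complex \<Rightarrow> complex) \<Rightarrow> nat \<Rightarrow> complex" where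
  "DD_ratio b x F k = DD k (\<lambda>i. b (Suc i)) x F / DD k b x F"

text \<open>The distance \<open>\<bar>1/u - b\<bar>\<close>, read as \<open>+\<infinity>\<close> when \<open>u = 0\<close>.\<close>

definition recip_dist :: "complex \<Rightarrow> complex \<Rightarrow> ereal" where
  "recip_dist u b = (if u = 0 then \<infinity> else ereal (cmod (1 / u - b)))"

end

theory Submission
  imports Defs
begin

text \<open>
  The series is a Newton expansion in rational functions: its \<open>n\<close>-th partial sum has poles only at
  \<open>1/x\<^sub>1, \<dots>, 1/x\<^sub>n\<close> and interpolates \<open>F\<close> at \<open>b\<^sub>0, \<dots>, b\<^sub>n\<close>. At a node \<open>b\<^sub>j\<close> all terms with index
  beyond \<open>j\<close> vanish, so there the series is a finite sum with value \<open>F(b\<^sub>j)\<close>. The nodes are distinct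
  and accumulate at \<open>\<beta>\<close>; hence, once the series is known to converge to a holomorphic function near
  \<open>\<beta>\<close>, that function is \<open>F\<close> by the identity theorem.

  Both halves of the argument rest on one identity, \<open>node_sum_recurrence\<close>, which relates the
  divided difference of \<open>W(t)(1 - yt)\<close> on a set of nodes to those of \<open>W\<close> with one of two nodes
  omitted. Omitting the last node and an extra node \<open>z\<close> yields the remainder formula
  \<open>interpolation_remainder\<close> by a telescoping induction, and with it the values at the nodes. Omitting
  \<open>b\<^sub>0\<close> and \<open>b\<^bsub>k+1\<^esub>\<close> expresses the quotient of the \<open>(k+1)\<close>-st by the \<open>k\<close>-th coefficient through
  \<open>\<lambda>\<^sub>k\<close>, with the denominator \<open>b\<^sub>0 - b\<^bsub>k+1\<^esub>\<close>. As this denominator tends to \<open>b\<^sub>0 - \<beta> \<noteq> 0\<close> and \<open>\<lambda>\<^sub>k\<close> is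
  bounded, the coefficients grow at most geometrically (\<open>DD_geometric_growth\<close>).

  Convergence is then geometric: apart from the bounded factor \<open>1 - x\<^sub>k b\<^sub>k\<close>, passing from one term to
  the next multiplies by a bounded quantity times \<open>(b\<^sub>k - z)/(1 - z x\<^bsub>k+1\<^esub>)\<close>. The numerator is eventually as small as desired for \<open>z\<close> near \<open>\<beta>\<close>,
  and the denominator stays away from 0 because the poles \<open>1/x\<^sub>i\<close> stay away from \<open>\<beta>\<close>
  (\<open>distance_to_reciprocal\<close>, \<open>uniform_convergence_near_limit\<close>).
\<close>

section \<open>Divided differences on a set of nodes\<close>

text \<open>
  For a set of \<open>k + 1\<close> nodes this is \<open>(-1)\<^sup>k\<close> times the classical divided difference of \<open>W\<close>.
  Indexing by the set instead of a list makes the symmetry in the nodes automatic, so that any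
  node can be removed.
\<close>

definition node_sum :: "('a::field \<Rightarrow> 'a) \<Rightarrow> 'a set \<Rightarrow> 'a" where
  "node_sum W C = (\<Sum>c\<in>C. W c / (\<Prod>a\<in>C - {c}. a - c))"

text \<open>
  Removing a node amounts to multiplying the function by \<open>p - t\<close>, which puts divided differences on
  different subsets over the common set \<open>C\<close>, where they can be compared termwise.
\<close>

lemma node_sum_remove:
  assumes "finite C" "p \<in> C"
  shows "node_sum W (C - {p}) = (\<Sum>c\<in>C. W c * (p - c) / (\<Prod>a\<in>C - {c}. a - c))"
proof -
  have "node_sum W (C - {p}) = (\<Sum>c\<in>C - {p}. W c * (p - c) / (\<Prod>a\<in>C - {c}. a - c))"
    unfolding node_sum_def
  proof (rule sum.cong)
    fix c assume c: "c \<in> C - {p}"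
    have "C - {c} - {p} = C - {p} - {c}" by auto
    moreover have "(\<Prod>a\<in>C - {c}. a - c) = (p - c) * (\<Prod>a\<in>C - {c} - {p}. a - c)"
      using assms c by (intro prod.remove) auto
    ultimately have "(\<Prod>a\<in>C - {c}. a - c) = (p - c) * (\<Prod>a\<in>C - {p} - {c}. a - c)"
      by simp
    moreover have "W c * (p - c) / ((p - c) * Q) = W c / Q" for Q using c by auto
    ultimately show "W c / (\<Prod>a\<in>C - {p} - {c}. a - c) = W c * (p - c) / (\<Prod>a\<in>C - {c}. a - c)"
      by metis
  qed simp
  also have "\<dots> = (\<Sum>c\<in>C. W c * (p - c) / (\<Prod>a\<in>C - {c}. a - c))"
    using assms by (intro sum.mono_neutral_left) auto
  finally show ?thesis .
qed

text \<open>
  Over the common node set the claim reduces, for each node \<open>c\<close>, to the identity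
  \<open>(p - q)(1 - yc) = (1 - yq)(p - c) - (1 - yp)(q - c)\<close>, the expansion of the linear polynomial
  \<open>1 - yt\<close> from its values at \<open>p\<close> and \<open>q\<close>.
\<close>

lemma node_sum_recurrence:
  assumes "finite C" "p \<in> C" "q \<in> C"
  shows "(p - q) * node_sum (\<lambda>t. W t * (1 - y * t)) C
    = (1 - y * q) * node_sum W (C - {p}) - (1 - y * p) * node_sum W (C - {q})"
proof -
  have "(p - q) * (W c * (1 - y * c) / P)
      = (1 - y * q) * (W c * (p - c) / P) - (1 - y * p) * (W c * (q - c) / P)" for c P
  proof -
    have "(p - q) * (1 - y * c) = (1 - y * q) * (p - c) - (1 - y * p) * (q - c)"
      by (simp add: algebra_simps)
    hence "(p - q) * (W c * (1 - y * c) / P)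
        = ((1 - y * q) * (p - c) - (1 - y * p) * (q - c)) * (W c / P)"
      by (metis (no_types, lifting) mult.assoc mult.commute times_divide_eq_right)
    thus ?thesis
      by (simp only: left_diff_distrib[of "(1 - y * q) * (p - c)"]) (simp add: mult_ac)
  qed
  thus ?thesis
    unfolding node_sum_remove[OF assms(1,2)] node_sum_remove[OF assms(1,3)]
    by (simp only: node_sum_def sum_distrib_left sum_subtractf)
qed

definition weight :: "(nat \<Rightarrow> complex) \<Rightarrow> (complex \<Rightarrow> complex) \<Rightarrow> nat \<Rightarrow> complex \<Rightarrow> complex" where
  "weight x F k t = F t * (\<Prod>i=1..<k. 1 - x i * t)"

lemma weight_Suc: "k \<ge> 1 \<Longrightarrow> weight x F (Suc k) = (\<lambda>t. weight x F k t * (1 - x k * t))"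
  by (auto simp: weight_def fun_eq_iff)

lemma DD_eq_node_sum:
  assumes "inj_on c {..k}" "k \<ge> 1"
  shows "DD k c x F = node_sum (weight x F k) (c ` {..k})"
proof -
  have "node_sum (weight x F k) (c ` {..k})
      = (\<Sum>j\<le>k. weight x F k (c j) / (\<Prod>a\<in>c ` {..k} - {c j}. a - c j))"
    unfolding node_sum_def using assms by (simp add: sum.reindex)
  also have "\<dots> = (\<Sum>j\<le>k. weight x F k (c j) / (\<Prod>i\<in>{..k} - {j}. c i - c j))"
  proof (rule sum.cong)
    fix j assume j: "j \<in> {..k}"
    have "c ` {..k} - {c j} = c ` ({..k} - {j})"
      using inj_on_image_set_diff[OF assms(1), of "{..k}" "{j}"] j by auto
    moreover have "inj_on c ({..k} - {j})" using assms(1) by (rule inj_on_subset) auto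
    ultimately show "weight x F k (c j) / (\<Prod>a\<in>c ` {..k} - {c j}. a - c j) =
        weight x F k (c j) / (\<Prod>i\<in>{..k} - {j}. c i - c j)"
      by (simp add: prod.reindex)
  qed simp
  finally show ?thesis using assms by (simp add: DD_def weight_def atLeast0AtMost)
qed

text \<open>
  This is where the shifted node sequence of \<open>\<lambda>\<^sub>k\<close> comes from: it is what remains of
  \<open>b\<^sub>0, \<dots>, b\<^bsub>k+1\<^esub>\<close> when \<open>b\<^sub>0\<close> is dropped. The case \<open>k = 0\<close> is excluded because the value of the
  operator there is fixed by a separate convention.
\<close>

lemma DD_Suc:
  assumes "inj b" "k \<ge> 1"
  shows "(b 0 - b (Suc k)) * DD (Suc k) b x F
    = (1 - x k * b (Suc k)) * DD k (\<lambda>i. b (Suc i)) x F - (1 - x k * b 0) * DD k b x F"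
proof -
  let ?C = "b ` {..Suc k}"
  have "?C - {b 0} = b ` ({..Suc k} - {0})" using assms(1) by (auto simp: inj_def)
  also have "{..Suc k} - {0} = Suc ` {..k}" by (auto simp: image_iff dest: not0_implies_Suc)
  finally have 1: "?C - {b 0} = (\<lambda>i. b (Suc i)) ` {..k}" by (simp add: image_image)
  have 2: "?C - {b (Suc k)} = b ` {..k}"
    using inj_image_mem_iff[OF assms(1), of "Suc k" "{..k}"] by (auto simp: atMost_Suc)
  have inj: "inj_on b A" "inj_on (\<lambda>i. b (Suc i)) A" for A
    using assms(1) by (auto simp: inj_def inj_on_def)
  show ?thesis
    using node_sum_recurrence[of ?C "b 0" "b (Suc k)" "weight x F k" "x k"] assms(2)
    by (simp add: DD_eq_node_sum inj weight_Suc 1 2)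
qed

section \<open>Rational interpolation\<close>

definition rat_basis :: "(nat \<Rightarrow> complex) \<Rightarrow> (nat \<Rightarrow> complex) \<Rightarrow> nat \<Rightarrow> complex \<Rightarrow> complex" where
  "rat_basis b x k z = (\<Prod>i<k. b i - z) / (\<Prod>i=1..k. 1 - z * x i)"

lemma rat_basis_0 [simp]: "rat_basis b x 0 z = 1"
  by (simp add: rat_basis_def)

lemma rat_basis_Suc:
  "rat_basis b x (Suc k) z = rat_basis b x k z * ((b k - z) / (1 - z * x (Suc k)))"
  by (simp add: rat_basis_def)

lemma rat_basis_at_node: "j < k \<Longrightarrow> rat_basis b x k (b j) = 0"
  by (auto simp: rat_basis_def)

text \<open>
  The remainder is the divided difference with \<open>z\<close> as an additional node. The recurrence, with the
  new node \<open>b\<^bsub>n+1\<^esub>\<close> and \<open>z\<close> as the omitted nodes, says precisely that consecutive remainders differ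
  by the next term of the series.
\<close>

lemma interpolation_remainder:
  assumes "inj_on b {..n}" "z \<notin> b ` {..n}" "1 - x 0 * b 0 \<noteq> 0" "\<forall>i\<ge>1. 1 - z * x i \<noteq> 0"
  shows "F z - (\<Sum>k\<le>n. (1 - x k * b k) * DD k b x F * rat_basis b x k z)
    = node_sum (weight x F (Suc n)) (insert z (b ` {..n})) * (rat_basis b x n z * (b n - z))"
  using assms(1,2)
proof (induction n)
  case 0
  hence "z \<noteq> b 0" by auto
  hence "node_sum (weight x F (Suc 0)) {z, b 0} = F z / (b 0 - z) + F (b 0) / (z - b 0)"
    by (auto simp: node_sum_def weight_def insert_Diff_if)
  thus ?case using assms(3) \<open>z \<noteq> b 0\<close>
    by (simp add: DD_def) (simp add: divide_simps; simp add: algebra_simps)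
next
  case (Suc n)
  let ?C = "insert z (b ` {..Suc n})"
  let ?E = "node_sum (weight x F (Suc (Suc n))) ?C"
  let ?E' = "node_sum (weight x F (Suc n)) (insert z (b ` {..n}))"
  have *: "b (Suc n) \<notin> b ` {..n}" "b (Suc n) \<noteq> z"
    using Suc.prems inj_on_image_mem_iff[OF Suc.prems(1), of "Suc n" "{..n}"] by auto
  have D1: "?C - {b (Suc n)} = insert z (b ` {..n})"
    unfolding atMost_Suc using * by blast
  have D2: "?C - {z} = b ` {..Suc n}" using Suc.prems by auto
  have nz: "1 - z * x (Suc n) \<noteq> 0" using assms(4) by auto
  have E: "(b (Suc n) - z) * ?E
      = (1 - z * x (Suc n)) * ?E' - (1 - x (Suc n) * b (Suc n)) * DD (Suc n) b x F"
    using node_sum_recurrence[of ?C "b (Suc n)" z "weight x F (Suc n)" "x (Suc n)"] Suc.prems(1)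
    by (simp only: D1 D2) (simp add: weight_Suc DD_eq_node_sum mult.commute)
  have "inj_on b {..n}" using Suc.prems(1) by (rule inj_on_subset) auto
  moreover have "z \<notin> b ` {..n}" using Suc.prems(2) by (simp add: atMost_Suc)
  ultimately have "F z - (\<Sum>k\<le>n. (1 - x k * b k) * DD k b x F * rat_basis b x k z)
      = ?E' * (rat_basis b x n z * (b n - z))" by (rule Suc.IH)
  also have "rat_basis b x n z * (b n - z) = rat_basis b x (Suc n) z * (1 - z * x (Suc n))"
    using nz by (simp add: rat_basis_Suc)
  finally have "F z - (\<Sum>k\<le>Suc n. (1 - x k * b k) * DD k b x F * rat_basis b x k z)
      = rat_basis b x (Suc n) z *
        ((1 - z * x (Suc n)) * ?E' - (1 - x (Suc n) * b (Suc n)) * DD (Suc n) b x F)"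
    by (simp add: algebra_simps)
  also have "\<dots> = ?E * (rat_basis b x (Suc n) z * (b (Suc n) - z))"
    by (simp add: E[symmetric])
  finally show ?case .
qed

text \<open>
  For \<open>j = n + 1\<close> the remainder after the terms \<open>0, \<dots>, n\<close> at \<open>z = b\<^sub>j\<close> is the divided difference on
  \<open>b\<^sub>0, \<dots>, b\<^sub>j\<close>, so it equals the term of index \<open>j\<close>, the last one
  that can be nonzero at \<open>b\<^sub>j\<close>.
\<close>

lemma interpolation_at_node:
  assumes "inj b" "1 - x 0 * b 0 \<noteq> 0" "\<forall>i\<ge>1. 1 - b j * x i \<noteq> 0"
  shows "(\<lambda>k. (1 - x k * b k) * DD k b x F * rat_basis b x k (b j)) sums F (b j)"
proof -
  let ?t = "\<lambda>k. (1 - x k * b k) * DD k b x F * rat_basis b x k (b j)"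
  have "?t sums sum ?t {..j}"
    by (rule sums_finite) (auto simp: rat_basis_at_node)
  moreover have "sum ?t {..j} = F (b j)"
  proof (cases j)
    case 0
    thus ?thesis using assms(2) by (simp add: DD_def)
  next
    case (Suc n)
    have notin: "b j \<notin> b ` {..n}" using assms(1) Suc by (simp add: inj_image_mem_iff)
    have set: "insert (b j) (b ` {..n}) = b ` {..j}"
      by (simp add: Suc atMost_Suc)
    have inj: "inj_on b A" for A using assms(1) by (rule inj_on_subset) auto
    have "1 - x j * b j \<noteq> 0" using assms(3) Suc by (auto simp: mult.commute)
    hence "?t j = DD j b x F * (rat_basis b x n (b j) * (b n - b j))"
      by (simp add: Suc rat_basis_Suc mult.commute)
    also have "\<dots> = F (b j) - sum ?t {..n}"
      using interpolation_remainder[of b n "b j" x F] inj notin assms(2,3)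
      unfolding set by (simp add: DD_eq_node_sum[OF inj] Suc)
    finally show ?thesis by (simp add: Suc)
  qed
  ultimately show ?thesis by simp
qed

section \<open>Convergence near the limit node\<close>

text \<open>
  A bound on \<open>1 - \<beta>u\<close> that does not depend on \<open>u\<close>: large \<open>u\<close> are controlled by
  \<open>\<bar>u\<bar> \<bar>1/u - \<beta>\<bar> \<ge> \<delta>\<bar>u\<bar>\<close> and small \<open>u\<close> by \<open>1 - \<bar>\<beta>\<bar> \<bar>u\<bar>\<close>. In the combination of these two bounds with
  weights \<open>\<bar>\<beta>\<bar>\<close> and \<open>\<delta>\<close> the terms in \<open>\<bar>u\<bar>\<close> cancel.
\<close>

lemma distance_to_reciprocal:
  assumes "ereal \<delta> \<le> recip_dist u \<beta>" "\<delta> > 0"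
  shows "\<delta> / (\<delta> + cmod \<beta>) \<le> cmod (1 - \<beta> * u)"
proof -
  have 1: "\<delta> * cmod u \<le> cmod (1 - \<beta> * u)"
  proof (cases "u = 0")
    case False
    hence "1 - \<beta> * u = u * (1 / u - \<beta>)" by (simp add: field_simps)
    moreover have "\<delta> \<le> cmod (1 / u - \<beta>)" using assms False by (simp add: recip_dist_def)
    ultimately show ?thesis by (simp add: norm_mult mult.commute[of \<delta>] mult_left_mono)
  qed simp
  have 2: "1 - cmod \<beta> * cmod u \<le> cmod (1 - \<beta> * u)"
    using norm_triangle_ineq2[of 1 "\<beta> * u"] by (simp add: norm_mult)
  have "\<delta> = cmod \<beta> * (\<delta> * cmod u) + \<delta> * (1 - cmod \<beta> * cmod u)"
    by (simp add: algebra_simps)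
  also have "\<dots> \<le> cmod \<beta> * cmod (1 - \<beta> * u) + \<delta> * cmod (1 - \<beta> * u)"
    using 1 2 assms(2) by (intro add_mono mult_left_mono) auto
  finally have "\<delta> \<le> (\<delta> + cmod \<beta>) * cmod (1 - \<beta> * u)" by (simp add: algebra_simps)
  moreover have "\<delta> + cmod \<beta> > 0" using assms(2) by (simp add: add_pos_nonneg)
  ultimately show ?thesis by (simp add: divide_le_eq mult.commute)
qed

text \<open>
  Divide the recurrence \<open>DD_Suc\<close> by \<open>b\<^sub>0 - b\<^bsub>k+1\<^esub>\<close>, which is bounded away from 0 for large \<open>k\<close>: every other
  factor on its right-hand side is bounded, relative to the \<open>k\<close>-th coefficient.
\<close>

lemma DD_geometric_growth:
  assumes "inj b" "b \<longlonglongrightarrow> \<beta>" "\<beta> \<noteq> b 0" "bounded (range x)"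
    and nz: "\<And>k. DD k b x F \<noteq> 0"
    and "limsup (\<lambda>k. ereal (cmod (DD_ratio b x F k))) < \<infinity>"
  obtains M where "M > 0"
    "\<forall>\<^sub>F k in sequentially. cmod (DD (Suc k) b x F) \<le> M * cmod (DD k b x F)"
proof -
  obtain R where R: "R > 0" "\<And>i. cmod (x i) \<le> R"
    using assms(4) unfolding bounded_pos by auto
  obtain B where B: "B > 0" "\<And>i. cmod (b i) \<le> B"
    using convergent_imp_bounded[OF assms(2)] unfolding bounded_pos by auto
  obtain L where L: "limsup (\<lambda>k. ereal (cmod (DD_ratio b x F k))) < ereal L"
    using assms(6) less_ereal.simps ereal_dense2 by blast
  have ev1: "\<forall>\<^sub>F k in sequentially. cmod (DD_ratio b x F k) < L"
    using Limsup_lessD[OF L] by simp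
  define e where "e = cmod (\<beta> - b 0) / 2"
  have e: "e > 0" using assms(3) by (simp add: e_def)
  have "(\<lambda>k. cmod (b (Suc k) - b 0)) \<longlonglongrightarrow> cmod (\<beta> - b 0)"
    using assms(2) by (intro tendsto_intros LIMSEQ_Suc)
  hence ev2: "\<forall>\<^sub>F k in sequentially. e < cmod (b (Suc k) - b 0)"
    by (rule order_tendstoD) (use e in \<open>simp add: e_def\<close>)
  define K where "K = 1 + R * B"
  have K: "K > 0" using R(1) B(1) by (simp add: K_def add_pos_pos)
  have Kle: "cmod (1 - x i * b j) \<le> K" for i j
  proof -
    have "cmod (1 - x i * b j) \<le> 1 + cmod (x i) * cmod (b j)"
      using norm_triangle_ineq4[of 1 "x i * b j"] by (simp add: norm_mult)
    also have "\<dots> \<le> K" unfolding K_def using R B(2) by (intro add_left_mono mult_mono) auto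
    finally show ?thesis .
  qed
  define M where "M = K * (\<bar>L\<bar> + 1) / e"
  have "M > 0" using K e by (simp add: M_def)
  moreover have "\<forall>\<^sub>F k in sequentially. cmod (DD (Suc k) b x F) \<le> M * cmod (DD k b x F)"
    using ev1 ev2 eventually_ge_at_top[of 1]
  proof eventually_elim
    case (elim k)
    let ?d = "DD k b x F" and ?d' = "DD k (\<lambda>i. b (Suc i)) x F"
    have d': "cmod ?d' \<le> \<bar>L\<bar> * cmod ?d"
      using elim(1) nz[of k] by (simp add: DD_ratio_def norm_divide divide_less_eq)
        (smt (verit) mult_right_mono norm_ge_zero)
    have "e * cmod (DD (Suc k) b x F) \<le> cmod (b 0 - b (Suc k)) * cmod (DD (Suc k) b x F)"
      using elim(2) by (intro mult_right_mono) (auto simp: norm_minus_commute)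
    also have "\<dots> = cmod ((1 - x k * b (Suc k)) * ?d' - (1 - x k * b 0) * ?d)"
      using DD_Suc[OF assms(1) elim(3), of x F] by (metis norm_mult)
    also have "\<dots> \<le> cmod (1 - x k * b (Suc k)) * cmod ?d' + cmod (1 - x k * b 0) * cmod ?d"
      by (metis norm_mult norm_triangle_ineq4)
    also have "\<dots> \<le> K * (\<bar>L\<bar> * cmod ?d) + K * cmod ?d"
      using Kle K d' by (intro add_mono mult_mono) auto
    also have "\<dots> = e * (M * cmod ?d)" using e by (simp add: M_def field_simps)
    finally show ?case using e by simp
  qed
  ultimately show ?thesis using that by blast
qed

text \<open>
  The convergence argument uses only the geometric growth of the coefficients \<open>a\<^sub>k\<close>, whatever their
  origin. On a small ball each term of \<open>\<Sum> a\<^sub>k R\<^sub>k(z)\<close>, with \<open>R\<^sub>k\<close> the rational basis, is eventually at most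
  half the preceding one; the factors \<open>1 - x\<^sub>k b\<^sub>k\<close> are left out of this comparison, since they
  may vanish, and are only bounded.
\<close>

lemma uniform_convergence_near_limit:
  fixes b x a :: "nat \<Rightarrow> complex"
  assumes "b \<longlonglongrightarrow> \<beta>" "bounded (range x)" "\<delta> > 0" "\<And>i. \<delta> \<le> cmod (1 - \<beta> * x i)"
    and M: "M > 0" "\<forall>\<^sub>F k in sequentially. cmod (a (Suc k)) \<le> M * cmod (a k)"
  obtains r where "r > 0" "\<And>z i. z \<in> ball \<beta> r \<Longrightarrow> 1 - z * x i \<noteq> 0"
    "uniform_limit (ball \<beta> r)
       (\<lambda>n z. \<Sum>k<n. (1 - x k * b k) * a k * rat_basis b x k z)
       (\<lambda>z. \<Sum>k. (1 - x k * b k) * a k * rat_basis b x k z) sequentially"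
proof -
  obtain R where R: "R > 0" "\<And>i. cmod (x i) \<le> R"
    using assms(2) unfolding bounded_pos by auto
  obtain B where B: "B > 0" "\<And>i. cmod (b i) \<le> B"
    using convergent_imp_bounded[OF assms(1)] unfolding bounded_pos by auto
  \<comment> \<open>The first bound on \<open>r\<close> keeps \<open>1 - z x\<^sub>i\<close> at distance at least \<open>\<delta>/2\<close> from 0 on the ball. The second makes
    the ratio of consecutive terms, at most \<open>M (2r) / c\<close>, no larger than \<open>1/2\<close>.\<close>
  define c where "c = \<delta> / 2"
  define r where "r = min (c / R) (c / (4 * M))"
  have c: "c > 0" using assms(3) by (simp add: c_def)
  have r: "r > 0" "r * R \<le> c" "M * (2 * r) \<le> c / 2"
  proof -
    show "r > 0" using c R M by (simp add: r_def)
    have "r \<le> c / R" "r \<le> c / (4 * M)" by (auto simp: r_def)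
    thus "r * R \<le> c" "M * (2 * r) \<le> c / 2" using R(1) M(1) by (auto simp: field_simps)
  qed
  have low: "c \<le> cmod (1 - z * x i)" if "z \<in> ball \<beta> r" for z i
  proof -
    have "cmod ((z - \<beta>) * x i) \<le> r * R"
      unfolding norm_mult using that R(2)[of i] r(1)
      by (intro mult_mono) (auto simp: dist_norm norm_minus_commute)
    moreover have "1 - \<beta> * x i = (1 - z * x i) + (z - \<beta>) * x i" by (simp add: algebra_simps)
    hence "cmod (1 - \<beta> * x i) \<le> cmod (1 - z * x i) + cmod ((z - \<beta>) * x i)"
      by (metis norm_triangle_ineq)
    ultimately show ?thesis using assms(4)[of i] r(2) by (simp add: c_def)
  qed
  have "\<forall>\<^sub>F k in sequentially. dist (b k) \<beta> < r" using assms(1) r(1) by (rule tendstoD)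
  with M(2) have "\<forall>\<^sub>F k in sequentially. cmod (a (Suc k)) \<le> M * cmod (a k) \<and> dist (b k) \<beta> < r"
    by eventually_elim auto
  then obtain N where N: "\<And>k. k \<ge> N \<Longrightarrow> cmod (a (Suc k)) \<le> M * cmod (a k)"
      "\<And>k. k \<ge> N \<Longrightarrow> dist (b k) \<beta> < r"
    unfolding eventually_sequentially by blast
  have step: "cmod (a (Suc k) * rat_basis b x (Suc k) z) \<le> cmod (a k * rat_basis b x k z) / 2"
    if "z \<in> ball \<beta> r" "k \<ge> N" for z k
  proof -
    have "cmod (b k - z) \<le> 2 * r"
      using N(2)[OF that(2)] that(1) dist_triangle[of "b k" z \<beta>] by (simp add: dist_norm)
    hence "cmod (b k - z) / cmod (1 - z * x (Suc k)) \<le> 2 * r / c"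
      using low[OF that(1)] c r(1) by (intro frac_le) auto
    hence "cmod (a (Suc k)) * (cmod (b k - z) / cmod (1 - z * x (Suc k)))
        \<le> (M * cmod (a k)) * (2 * r / c)"
      using N(1)[OF that(2)] M(1) by (intro mult_mono) auto
    also have "\<dots> = (M * (2 * r)) / c * cmod (a k)" by simp
    also have "\<dots> \<le> 1 / 2 * cmod (a k)"
      using r(3) c by (intro mult_right_mono) (auto simp: divide_le_eq)
    finally have "cmod (a (Suc k)) * (cmod (b k - z) / cmod (1 - z * x (Suc k))) * cmod (rat_basis b x k z)
        \<le> 1 / 2 * cmod (a k) * cmod (rat_basis b x k z)"
      by (rule mult_right_mono) auto
    thus ?thesis by (simp add: rat_basis_Suc norm_mult norm_divide mult_ac)
  qed
  \<comment> \<open>The geometric comparison starts at index \<open>N\<close>, where the term is bounded factor by factor.\<close>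
  define U where "U = cmod (a N) * ((B + cmod \<beta> + r) ^ N / c ^ N)"
  have start: "cmod (a N * rat_basis b x N z) \<le> U" if z: "z \<in> ball \<beta> r" for z
  proof -
    have "cmod (b i - z) \<le> B + cmod \<beta> + r" for i
    proof -
      have "cmod (b i - z) \<le> cmod (b i) + cmod \<beta> + cmod (\<beta> - z)"
        by norm
      thus ?thesis using B(2)[of i] z by (simp add: dist_norm)
    qed
    hence "(\<Prod>i<N. cmod (b i - z)) \<le> (\<Prod>i<N. B + cmod \<beta> + r)"
      by (intro prod_mono) auto
    moreover have "(\<Prod>i=1..N. c) \<le> (\<Prod>i=1..N. cmod (1 - z * x i))"
      using low[OF z] c by (intro prod_mono) auto
    ultimately have "cmod (rat_basis b x N z) \<le> (B + cmod \<beta> + r) ^ N / c ^ N"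
      using c r(1) B(1) unfolding rat_basis_def norm_divide prod_norm[symmetric]
      by (intro frac_le) auto
    thus ?thesis unfolding U_def norm_mult by (intro mult_left_mono) auto
  qed
  have bound: "cmod (a (N + m) * rat_basis b x (N + m) z) \<le> U * (1 / 2) ^ m"
    if z: "z \<in> ball \<beta> r" for z m
  proof (induction m)
    case (Suc m)
    thus ?case using step[OF z, of "N + m"] by simp
  qed (use start[OF z] in simp)
  have K: "cmod (1 - x k * b k) \<le> 1 + R * B" for k
  proof -
    have "cmod (1 - x k * b k) \<le> 1 + cmod (x k) * cmod (b k)"
      using norm_triangle_ineq4[of 1 "x k * b k"] by (simp add: norm_mult)
    also have "\<dots> \<le> 1 + R * B" using R B(2) by (intro add_left_mono mult_mono) auto
    finally show ?thesis .
  qed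
  have tail: "cmod ((1 - x k * b k) * a k * rat_basis b x k z) \<le> (1 + R * B) * (U * (1 / 2) ^ (k - N))"
    if "z \<in> ball \<beta> r" "k \<ge> N" for z k
  proof -
    have "cmod (1 - x k * b k) * cmod (a k * rat_basis b x k z) \<le> (1 + R * B) * (U * (1 / 2) ^ (k - N))"
      using K[of k] bound[OF that(1), of "k - N"] that(2) R(1) B(1) by (intro mult_mono) auto
    thus ?thesis by (simp add: norm_mult mult_ac)
  qed
  have "summable (\<lambda>m. (1 + R * B) * (U * (1 / 2) ^ (m + N - N)))"
    by (intro summable_mult) (simp add: summable_geometric)
  hence "summable (\<lambda>k. (1 + R * B) * (U * (1 / 2) ^ (k - N)))"
    by (subst summable_iff_shift[of _ N, symmetric]) simp
  hence unif: "uniform_limit (ball \<beta> r)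
       (\<lambda>n z. \<Sum>k<n. (1 - x k * b k) * a k * rat_basis b x k z)
       (\<lambda>z. \<Sum>k. (1 - x k * b k) * a k * rat_basis b x k z) sequentially"
  proof (intro Weierstrass_m_test_ev)
    show "\<forall>\<^sub>F k in sequentially. \<forall>z\<in>ball \<beta> r.
        cmod ((1 - x k * b k) * a k * rat_basis b x k z) \<le> (1 + R * B) * (U * (1 / 2) ^ (k - N))"
      using eventually_ge_at_top[of N] by eventually_elim (use tail in blast)
  qed
  show ?thesis
  proof (rule that[OF r(1) _ unif])
    show "1 - z * x i \<noteq> 0" if "z \<in> ball \<beta> r" for z i using low[OF that, of i] c by auto
  qed
qed

section \<open>The expansion\<close>

theorem theorem3p2:
  fixes \<Omega> :: "complex set"
    and F :: "complex \<Rightarrow> complex"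
    and b x :: "nat \<Rightarrow> complex"
    and \<beta> :: complex
  assumes "open \<Omega>"
    and "F analytic_on \<Omega>"
    and "range b \<subseteq> \<Omega>"
    and "range x \<subseteq> \<Omega>"
    and "inj b"
    and "bounded (range x)"
    and "b \<longlonglongrightarrow> \<beta>"
    and "\<beta> \<in> \<Omega>"
    and "\<beta> \<noteq> b 0"
    and "(INF i. recip_dist (x i) \<beta>) > 0"
    and "1 - x 0 * b 0 \<noteq> 0"
    and "1 - x 0 * b 1 \<noteq> 0"
    and "\<And>k. DD k b x F \<noteq> 0"
    and "limsup (\<lambda>k. ereal (cmod (DD_ratio b x F k))) < \<infinity>"
  shows "\<exists>\<Omega>\<^sub>1. open \<Omega>\<^sub>1 \<and> \<Omega>\<^sub>1 \<subseteq> \<Omega> \<and> \<beta> \<in> \<Omega>\<^sub>1 \<and>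
           (\<forall>z\<in>\<Omega>\<^sub>1. (\<forall>i\<ge>1. 1 - z * x i \<noteq> 0) \<and>
              (\<lambda>k. (1 - x k * b k) * DD k b x F *
                   ((\<Prod>i<k. b i - z) / (\<Prod>i=1..k. 1 - z * x i))) sums F z)"
proof -
  let ?t = "\<lambda>k z. (1 - x k * b k) * DD k b x F * rat_basis b x k z"
  obtain \<delta> where "0 < ereal \<delta>" "ereal \<delta> < (INF i. recip_dist (x i) \<beta>)"
    using ereal_dense2[OF assms(10)] by blast
  hence \<delta>: "\<delta> > 0" "ereal \<delta> \<le> recip_dist (x i) \<beta>" for i
    using less_INF_D[of "ereal \<delta>" "\<lambda>i. recip_dist (x i) \<beta>" UNIV i] by auto
  define \<gamma> where "\<gamma> = \<delta> / (\<delta> + cmod \<beta>)"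
  have \<gamma>: "\<gamma> > 0" "\<And>i. \<gamma> \<le> cmod (1 - \<beta> * x i)"
    using \<delta>(1) distance_to_reciprocal[OF \<delta>(2) \<delta>(1)] by (auto simp: \<gamma>_def add_pos_nonneg)
  obtain M where M: "M > 0"
      "\<forall>\<^sub>F k in sequentially. cmod (DD (Suc k) b x F) \<le> M * cmod (DD k b x F)"
    using DD_geometric_growth[OF assms(5,7,9,6,13,14)] by blast
  obtain r where r: "r > 0" "\<And>z i. z \<in> ball \<beta> r \<Longrightarrow> 1 - z * x i \<noteq> 0"
      "uniform_limit (ball \<beta> r) (\<lambda>n z. \<Sum>k<n. ?t k z) (\<lambda>z. \<Sum>k. ?t k z) sequentially"
    by (rule uniform_convergence_near_limit[OF assms(7,6) \<gamma> M]) (rule that; blast)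
  obtain r' where r': "r' > 0" "ball \<beta> r' \<subseteq> \<Omega>"
    using assms(1,8) openE by blast
  define s where "s = min r r'"
  have s: "s > 0" "ball \<beta> s \<subseteq> \<Omega>" "ball \<beta> s \<subseteq> ball \<beta> r"
    using r(1) r' by (auto simp: s_def)
  define S where "S = (\<lambda>z. \<Sum>k. ?t k z)"
  have lim: "uniform_limit (ball \<beta> s) (\<lambda>n z. \<Sum>k<n. ?t k z) S sequentially"
    unfolding S_def using r(3) s(3) by (rule uniform_limit_on_subset)
  have sums: "(\<lambda>k. ?t k z) sums S z" if "z \<in> ball \<beta> s" for z
    unfolding sums_def using tendsto_uniform_limitI[OF lim that] by simp
  have holo_t: "(\<lambda>z. ?t k z) holomorphic_on ball \<beta> s" for k
    unfolding rat_basis_def using r(2) s(3) by (intro holomorphic_intros) auto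
  have holo_S: "S holomorphic_on ball \<beta> s"
  proof (rule holomorphic_uniform_sequence)
    show "(\<lambda>z. \<Sum>k<n. ?t k z) holomorphic_on ball \<beta> s" for n
      by (intro holomorphic_on_sum holo_t)
    fix z assume "z \<in> ball \<beta> s"
    then obtain d where d: "d > 0" "cball z d \<subseteq> ball \<beta> s"
      by (meson open_ball open_contains_cball)
    thus "\<exists>d>0. cball z d \<subseteq> ball \<beta> s \<and>
        uniform_limit (cball z d) (\<lambda>n z. \<Sum>k<n. ?t k z) S sequentially"
      using uniform_limit_on_subset[OF lim] by blast
  qed simp
  have holo_F: "F holomorphic_on ball \<beta> s"
    using analytic_imp_holomorphic[OF assms(2)] s(2) by (rule holomorphic_on_subset)
  have "\<forall>\<^sub>F j in sequentially. b j \<in> ball \<beta> s"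
    using tendstoD[OF assms(7) s(1)] by (simp add: dist_commute)
  then obtain J where J: "\<And>j. j \<ge> J \<Longrightarrow> b j \<in> ball \<beta> s"
    unfolding eventually_sequentially by blast
  define A where "A = b ` {J..}"
  have agree: "S (b j) = F (b j)" if "j \<ge> J" for j
  proof -
    have "(\<lambda>k. ?t k (b j)) sums F (b j)"
      using r(2) s(3) J[OF that] by (intro interpolation_at_node assms(5,11)) blast
    thus ?thesis using sums[OF J[OF that]] sums_unique2 by blast
  qed
  have "\<beta> islimpt A"
    unfolding islimpt_approachable
  proof (intro allI impI)
    fix e :: real assume "e > 0"
    with assms(7) have "\<forall>\<^sub>F j in sequentially. dist (b j) \<beta> < e" by (rule tendstoD)
    then obtain N where N: "\<And>j. j \<ge> N \<Longrightarrow> dist (b j) \<beta> < e"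
      unfolding eventually_sequentially by blast
    \<comment> \<open>The point \<open>\<beta>\<close> may itself be a node, but of two consecutive nodes at most one equals \<open>\<beta>\<close>.\<close>
    define n where "n = max N J"
    have "b n \<noteq> b (Suc n)" using assms(5) by (simp add: inj_eq)
    then obtain j where "j \<ge> n" "b j \<noteq> \<beta>" by (metis le_Suc_eq order_refl)
    thus "\<exists>y\<in>A. y \<noteq> \<beta> \<and> dist y \<beta> < e" using N by (auto simp: A_def n_def)
  qed
  have eq: "S z = F z" if "z \<in> ball \<beta> s" for z
  proof -
    have holo: "(\<lambda>z. S z - F z) holomorphic_on ball \<beta> s"
      using holo_S holo_F by (intro holomorphic_intros)
    have "A \<subseteq> ball \<beta> s" "\<beta> \<in> ball \<beta> s" using J s(1) by (auto simp: A_def)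
    moreover have "S a - F a = 0" if "a \<in> A" for a using that agree by (auto simp: A_def)
    ultimately have "S z - F z = 0"
      using analytic_continuation[OF holo open_ball connected_ball _ _ \<open>\<beta> islimpt A\<close> _ that] by blast
    thus ?thesis by simp
  qed
  show ?thesis
    using s r(2) sums eq
    by (intro exI[of _ "ball \<beta> s"]) (auto simp: rat_basis_def)
qed

end
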